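(* Let $\omega$ be a polynomial in one variable with real coefficients and degree at least $2$. For $t\in\mathbb{R}\setminus\{0\}$, $x,\xi\in\mathbb{R}$ and $\lambda>0$ define $$I(\lambda)=I(\lambda;x,\xi,t)=\int_{\mathbb{R}}e^{-i\left(t\,\omega(\lambda^2\xi-\lambda z)+\lambda xz\right)}e^{-\frac{z^2}{4}}\,dz.$$ Then for every $x_0\in\mathbb{R}$ and every $t\in\mathbb{R}\setminus\{0\}$ there exist a neighborhood $U\subseteq\mathbb{R}$ of $x_0$ and constants $C,\sigma,M,\lambda_0>0$ such that $$|I(\lambda)|\le Ce^{-\sigma\lambda^2}\qquad\text{for all }|\xi|>M,\ x\in U,\ \lambda>\lambda_0.$$
   Context: Up to the factor $\sqrt\pi$, $I(\sqrt\tau)$ is the FBI transform $P^\tau f(x,\tau\xi)$ of $f=K_t=\mathcal{F}^{-1}[e^{-it\omega}]$, where $P^\tau f(x,\xi)=\int_{\mathbb{R}}e^{-iy\xi}e^{-\tau(y-x)^2}f(y)\,dy$. *)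

theory Defs
  imports "HOL-Analysis.Analysis" "HOL-Probability.Distributions" "HOL-Computational_Algebra.Polynomial"
begin

definition I_integrand :: "real poly \<Rightarrow> real \<Rightarrow> real \<Rightarrow> real \<Rightarrow> real \<Rightarrow> real \<Rightarrow> complex" where
  "I_integrand \<omega> lam x \<xi> t z =
     exp (- \<i> * complex_of_real (t * poly \<omega> (lam\<^sup>2 * \<xi> - lam * z) + lam * x * z))
     * complex_of_real (exp (- (z\<^sup>2 / 4)))"

definition I_integral :: "real poly \<Rightarrow> real \<Rightarrow> real \<Rightarrow> real \<Rightarrow> real \<Rightarrow> complex" where
  "I_integral \<omega> lam x \<xi> t = (LINT z|lborel. I_integrand \<omega> lam x \<xi> t z)"

text \<open>The Bochner integral of a non-integrable function is \<open>0\<close> by convention; this does not occur here.\<close>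

lemma integrable_I_integrand: "integrable lborel (I_integrand \<omega> lam x \<xi> t)"
proof (rule Bochner_Integration.integrable_bound)
  have "integrable lborel (\<lambda>z. sqrt (4 * pi) * normal_density 0 (sqrt 2) z)"
    by simp
  then show "integrable lborel (\<lambda>z::real. exp (- (z\<^sup>2 / 4)))"
    by (simp add: normal_density_def real_sqrt_mult)
  show "I_integrand \<omega> lam x \<xi> t \<in> borel_measurable lborel"
    unfolding I_integrand_def
    by (simp, intro borel_measurable_continuous_onI continuous_intros) simp_all
  show "AE z in lborel. norm (I_integrand \<omega> lam x \<xi> t z) \<le> norm (exp (- (z\<^sup>2 / 4)))"
    by (simp add: I_integrand_def norm_mult)
qed

end

theory Submission
  imports Defs "HOL-Complex_Analysis.Cauchy_Integral_Theorem"
begin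

text \<open>
  The integrand extends to an entire function of \<open>z\<close>. For \<open>\<bar>z\<bar> > \<lambda>\<close> the Gaussian factor
  alone is small enough. The segment \<open>[-\<lambda>, \<lambda>]\<close> is deformed to the other two sides of the
  triangle with third vertex \<open>i s \<lambda>\<close>, where \<open>s\<close> is the common sign of \<open>t Re \<omega>'\<close> at all points
  \<open>\<lambda>\<^sup>2 \<xi> - \<lambda> z\<close>, \<open>z\<close> in the triangle: as \<open>\<omega>'\<close> is not constant, it is large and close to its
  leading term there once \<open>\<bar>\<xi>\<bar>\<close> is large. At the point \<open>u + i s v\<close> with \<open>\<bar>u\<bar> = \<lambda> - v\<close>
  the oscillating factor then contributes at most \<open>exp (- \<lambda> v)\<close>, and
  \<open>- \<lambda> v - (u\<^sup>2 - v\<^sup>2) / 4 = - \<lambda>\<^sup>2 / 4 - \<lambda> v / 2\<close>.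
\<close>

section \<open>Real polynomials at complex arguments near the real axis\<close>

abbreviation cpoly :: "real poly \<Rightarrow> complex poly" where
  "cpoly p \<equiv> map_poly complex_of_real p"

lemma poly_cpoly_of_real: "poly (cpoly p) (complex_of_real x) = complex_of_real (poly p x)"
  by (induction p) (simp_all add: map_poly_pCons)

lemma pderiv_cpoly: "pderiv (cpoly p) = cpoly (pderiv p)"
  by (rule poly_eqI) (simp add: coeff_pderiv coeff_map_poly)

text \<open>Induction along Horner's scheme. One constant \<open>R\<close> makes the point far from
  0 and the double cone around the real axis narrow. The comparison term is taken at the real part
  \<open>a\<close>, so it is real and has a sign.\<close>

lemma cpoly_leading_asymptotics:
  fixes p :: "real poly"
  assumes "p \<noteq> 0" "\<epsilon> > 0"
  shows "\<exists>R\<ge>1. \<forall>a b. \<bar>a\<bar> \<ge> R \<longrightarrow> R * \<bar>b\<bar> \<le> \<bar>a\<bar> \<longrightarrow>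
    cmod (poly (cpoly p) (Complex a b) - of_real (lead_coeff p * a ^ degree p))
      \<le> \<epsilon> * \<bar>a\<bar> ^ degree p"
  using assms
proof (induction p arbitrary: \<epsilon>)
  case 0
  then show ?case by simp
next
  case (pCons k p)
  show ?case
  proof (cases "p = 0")
    case True
    then show ?thesis using pCons.prems
      by (auto simp: map_poly_pCons intro!: exI[of _ 1])
  next
    case False
    define c where "c = lead_coeff p"
    define n where "n = degree p"
    obtain R where R: "R \<ge> 1" and approx:
      "\<And>a b. \<bar>a\<bar> \<ge> R \<Longrightarrow> R * \<bar>b\<bar> \<le> \<bar>a\<bar> \<Longrightarrow>
        cmod (poly (cpoly p) (Complex a b) - of_real (c * a ^ n)) \<le> \<epsilon> / 6 * \<bar>a\<bar> ^ n"
      using pCons.IH[of "\<epsilon> / 6"] False pCons.prems unfolding c_def n_def by auto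
    \<comment> \<open>The three error terms get \<open>\<epsilon> / 3\<close> each. The last two
      entries of the maximum control the new constant coefficient and the term coming from the
      imaginary part \<open>b\<close>; the tolerance \<open>\<epsilon> / 6\<close> for
      \<open>p\<close> allows for the factor
      \<open>cmod \<zeta> \<le> 2 * \<bar>a\<bar>\<close>.\<close>
    define S where "S = max R (max (3 * \<bar>k\<bar> / \<epsilon>) (3 * \<bar>c\<bar> / \<epsilon>))"
    have S: "S \<ge> R" "S \<ge> 3 * \<bar>k\<bar> / \<epsilon>" "S \<ge> 3 * \<bar>c\<bar> / \<epsilon>"
      by (simp_all add: S_def)
    have "cmod (poly (cpoly (pCons k p)) (Complex a b) - of_real (c * a ^ Suc n))
        \<le> \<epsilon> * \<bar>a\<bar> ^ Suc n" if a: "\<bar>a\<bar> \<ge> S" and b: "S * \<bar>b\<bar> \<le> \<bar>a\<bar>" for a b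
    proof -
      define \<zeta> where "\<zeta> = Complex a b"
      have a1: "\<bar>a\<bar> \<ge> 1" using a S R by linarith
      have "R * \<bar>b\<bar> \<le> S * \<bar>b\<bar>" using S by (intro mult_right_mono) auto
      with b have Rb: "R * \<bar>b\<bar> \<le> \<bar>a\<bar>" by linarith
      have "1 * \<bar>b\<bar> \<le> R * \<bar>b\<bar>" using R by (intro mult_right_mono) auto
      with Rb have "\<bar>b\<bar> \<le> \<bar>a\<bar>" by linarith
      moreover have "cmod \<zeta> \<le> \<bar>a\<bar> + \<bar>b\<bar>"
        using cmod_le[of \<zeta>] by (simp add: \<zeta>_def)
      ultimately have \<zeta>: "cmod \<zeta> \<le> 2 * \<bar>a\<bar>" by linarith
      \<comment> \<open>The leading term grows by the factor \<open>a\<close>, the polynomial by the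
        factor \<open>\<zeta>\<close>; the last summand corrects for the difference
        \<open>\<i> * b\<close>.\<close>
      have "poly (cpoly (pCons k p)) \<zeta> - of_real (c * a ^ Suc n)
          = of_real k + \<zeta> * (poly (cpoly p) \<zeta> - of_real (c * a ^ n))
            + \<i> * of_real b * of_real (c * a ^ n)"
        by (simp add: map_poly_pCons \<zeta>_def Complex_eq algebra_simps)
      also have "cmod \<dots> \<le> cmod (of_real k + \<zeta> * (poly (cpoly p) \<zeta> - of_real (c * a ^ n)))
            + cmod (\<i> * of_real b * of_real (c * a ^ n))"
        by (rule norm_triangle_ineq)
      also have "\<dots> \<le> cmod (of_real k) + cmod (\<zeta> * (poly (cpoly p) \<zeta> - of_real (c * a ^ n)))
            + cmod (\<i> * of_real b * of_real (c * a ^ n))"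
        by (intro add_mono norm_triangle_ineq order_refl)
      also have "\<dots> = \<bar>k\<bar> + cmod \<zeta> * cmod (poly (cpoly p) \<zeta> - of_real (c * a ^ n))
            + \<bar>c\<bar> * \<bar>b\<bar> * \<bar>a\<bar> ^ n"
        unfolding norm_mult norm_of_real norm_ii abs_mult power_abs by simp
      also have "\<dots> \<le> \<epsilon> / 3 * \<bar>a\<bar> ^ Suc n + \<epsilon> / 3 * \<bar>a\<bar> ^ Suc n + \<epsilon> / 3 * \<bar>a\<bar> ^ Suc n"
      proof (intro add_mono)
        have "3 * \<bar>k\<bar> / \<epsilon> \<le> \<bar>a\<bar>" using S(2) a by linarith
        then have "\<bar>k\<bar> \<le> \<epsilon> / 3 * \<bar>a\<bar>"
          using pCons.prems by (simp add: field_simps)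
        also have "\<dots> \<le> \<epsilon> / 3 * \<bar>a\<bar> ^ Suc n"
          using a1 pCons.prems self_le_power[of "\<bar>a\<bar>" "Suc n"] by (intro mult_left_mono) auto
        finally show "\<bar>k\<bar> \<le> \<epsilon> / 3 * \<bar>a\<bar> ^ Suc n" .
      next
        have "cmod \<zeta> * cmod (poly (cpoly p) \<zeta> - of_real (c * a ^ n))
          \<le> (2 * \<bar>a\<bar>) * (\<epsilon> / 6 * \<bar>a\<bar> ^ n)"
          using \<zeta> approx[of a b] a S Rb by (intro mult_mono) (auto simp: \<zeta>_def)
        then show "cmod \<zeta> * cmod (poly (cpoly p) \<zeta> - of_real (c * a ^ n))
          \<le> \<epsilon> / 3 * \<bar>a\<bar> ^ Suc n" by (simp add: algebra_simps)
      next
        have "3 * \<bar>c\<bar> / \<epsilon> * \<bar>b\<bar> \<le> S * \<bar>b\<bar>"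
          using S(3) by (rule mult_right_mono) auto
        with b have "3 * \<bar>c\<bar> / \<epsilon> * \<bar>b\<bar> \<le> \<bar>a\<bar>" by linarith
        then have "\<bar>c\<bar> * \<bar>b\<bar> \<le> \<epsilon> / 3 * \<bar>a\<bar>"
          using pCons.prems by (simp add: field_simps)
        then have "\<bar>c\<bar> * \<bar>b\<bar> * \<bar>a\<bar> ^ n \<le> \<epsilon> / 3 * \<bar>a\<bar> * \<bar>a\<bar> ^ n"
          by (rule mult_right_mono) auto
        then show "\<bar>c\<bar> * \<bar>b\<bar> * \<bar>a\<bar> ^ n \<le> \<epsilon> / 3 * \<bar>a\<bar> ^ Suc n" by (simp add: mult.assoc)
      qed
      finally show ?thesis by (simp add: \<zeta>_def)
    qed
    then show ?thesis
      using False S R unfolding c_def n_def by (intro exI[of _ S]) auto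
  qed
qed

text \<open>With tolerance half the leading coefficient, the real part differs from
  \<open>y = c * a ^ n\<close> by at most |y|/2, so it has the sign of \<open>y\<close> and size at
  least |y|/2. As the degree is positive, |y| is at least |c| |a|, which exceeds any prescribed 2K
  far out.\<close>

lemma Re_cpoly_lower_bound:
  fixes p :: "real poly"
  assumes "degree p \<ge> 1"
  shows "\<exists>R\<ge>1. \<forall>a b. \<bar>a\<bar> \<ge> R \<longrightarrow> R * \<bar>b\<bar> \<le> \<bar>a\<bar> \<longrightarrow>
    K \<le> sgn (lead_coeff p * a ^ degree p) * Re (poly (cpoly p) (Complex a b))"
proof -
  define c where "c = lead_coeff p"
  define n where "n = degree p"
  have p: "p \<noteq> 0" using assms by auto
  then have c: "\<bar>c\<bar> > 0" by (simp add: c_def)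
  obtain R where R: "R \<ge> 1" and approx:
    "\<And>a b. \<bar>a\<bar> \<ge> R \<Longrightarrow> R * \<bar>b\<bar> \<le> \<bar>a\<bar> \<Longrightarrow>
      cmod (poly (cpoly p) (Complex a b) - of_real (c * a ^ n)) \<le> \<bar>c\<bar> / 2 * \<bar>a\<bar> ^ n"
    using cpoly_leading_asymptotics[OF p, of "\<bar>c\<bar> / 2"] c unfolding c_def n_def by auto
  define S where "S = max R (2 * K / \<bar>c\<bar>)"
  have S: "S \<ge> R" "S \<ge> 2 * K / \<bar>c\<bar>" by (simp_all add: S_def)
  have "K \<le> sgn (c * a ^ n) * Re (poly (cpoly p) (Complex a b))"
    if a: "\<bar>a\<bar> \<ge> S" and b: "S * \<bar>b\<bar> \<le> \<bar>a\<bar>" for a b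
  proof -
    define y where "y = c * a ^ n"
    have a1: "\<bar>a\<bar> \<ge> 1" using a S R by linarith
    have "R * \<bar>b\<bar> \<le> S * \<bar>b\<bar>" using S by (intro mult_right_mono) auto
    with b have Rb: "R * \<bar>b\<bar> \<le> \<bar>a\<bar>" by linarith
    have "cmod (poly (cpoly p) (Complex a b) - of_real y) \<le> \<bar>y\<bar> / 2"
      using approx[of a b] a S Rb by (simp add: y_def abs_mult power_abs)
    with abs_Re_le_cmod[of "poly (cpoly p) (Complex a b) - of_real y"]
    have near: "\<bar>Re (poly (cpoly p) (Complex a b)) - y\<bar> \<le> \<bar>y\<bar> / 2" by simp
    have "2 * K / \<bar>c\<bar> \<le> \<bar>a\<bar>" using S(2) a by linarith
    then have "2 * K \<le> \<bar>c\<bar> * \<bar>a\<bar>"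
      using c by (simp add: field_simps)
    also have "\<dots> \<le> \<bar>c\<bar> * \<bar>a\<bar> ^ n"
      using a1 assms self_le_power[of "\<bar>a\<bar>" n] by (intro mult_left_mono) (auto simp: n_def)
    finally have "2 * K \<le> \<bar>y\<bar>" by (simp add: y_def abs_mult power_abs)
    with near have "K \<le> sgn y * Re (poly (cpoly p) (Complex a b))"
      using a1 c by (auto simp: sgn_if abs_if y_def split: if_splits)
    then show ?thesis by (simp add: y_def)
  qed
  then show ?thesis
    using S R unfolding c_def n_def by (intro exI[of _ S]) auto
qed

text \<open>On vertical lines the derivative of \<open>Im p\<close> is \<open>Re p'\<close>.\<close>

lemma Im_cpoly_mean_value:
  fixes p :: "real poly"
  shows "\<exists>\<theta>. \<bar>\<theta>\<bar> \<le> \<bar>b\<bar> \<and>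
    Im (poly (cpoly p) (Complex a b)) = b * Re (poly (cpoly (pderiv p)) (Complex a \<theta>))"
proof -
  define h where "h y = Im (poly (cpoly p) (of_real a + \<i> * of_real y))" for y :: real
  define h' where "h' y = Re (poly (cpoly (pderiv p)) (Complex a y))" for y :: real
  have h: "(h has_real_derivative h' y) (at y)" for y
  proof -
    have "((\<lambda>y::real. of_real a + \<i> * of_real y) has_vector_derivative \<i>) (at y)"
      by (auto intro!: derivative_eq_intros)
    from field_vector_diff_chain_at[OF this poly_DERIV[of "cpoly p"]]
    have "((\<lambda>y::real. poly (cpoly p) (of_real a + \<i> * of_real y)) has_vector_derivative
        \<i> * poly (cpoly (pderiv p)) (of_real a + \<i> * of_real y)) (at y)"
      by (simp add: o_def pderiv_cpoly)
    from bounded_linear.has_vector_derivative[OF bounded_linear_Im this]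
    show ?thesis
      by (simp add: h_def[abs_def] h'_def has_real_derivative_iff_has_vector_derivative Complex_eq)
  qed
  \<comment> \<open>Real coefficients make the polynomial real on the real axis, so the mean value
    formula has no constant term.\<close>
  have h0: "h 0 = 0" by (simp add: h_def poly_cpoly_of_real)
  have "\<exists>\<theta>. \<bar>\<theta>\<bar> \<le> \<bar>b\<bar> \<and> h b = b * h' \<theta>"
  proof (cases b "0 :: real" rule: linorder_cases)
    case less
    from MVT2[OF this, of h h'] h obtain y where "b < y" "y < 0" "h 0 - h b = (0 - b) * h' y"
      by blast
    with h0 show ?thesis by (intro exI[of _ y]) auto
  next
    case equal
    with h0 show ?thesis by auto
  next
    case greater
    from MVT2[OF this, of h h'] h obtain y where "0 < y" "y < b" "h b - h 0 = (b - 0) * h' y"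
      by blast
    with h0 show ?thesis by (intro exI[of _ y]) auto
  qed
  then show ?thesis by (simp add: h_def h'_def Complex_eq)
qed

section \<open>The entire extension of the integrand and its size on the deformed path\<close>

definition I_extension :: "real poly \<Rightarrow> real \<Rightarrow> real \<Rightarrow> real \<Rightarrow> real \<Rightarrow> complex \<Rightarrow> complex" where
  "I_extension \<omega> lam x \<xi> t z =
     exp (- \<i> * (of_real t * poly (cpoly \<omega>) (of_real (lam\<^sup>2 * \<xi>) - of_real lam * z)
           + of_real (lam * x) * z) - z\<^sup>2 / 4)"

lemma I_extension_of_real: "I_extension \<omega> lam x \<xi> t (of_real z) = I_integrand \<omega> lam x \<xi> t z"
proof -
  have "of_real (lam\<^sup>2 * \<xi>) - of_real lam * of_real z = complex_of_real (lam\<^sup>2 * \<xi> - lam * z)"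
    by simp
  then show ?thesis
    unfolding I_extension_def I_integrand_def exp_of_real[symmetric] exp_add[symmetric]
    by (simp only: poly_cpoly_of_real) simp
qed

lemma holomorphic_I_extension: "I_extension \<omega> lam x \<xi> t holomorphic_on S"
  unfolding I_extension_def by (intro holomorphic_intros) simp_all

lemma norm_I_extension:
  "norm (I_extension \<omega> lam x \<xi> t (Complex u v)) =
    exp (t * Im (poly (cpoly \<omega>) (Complex (lam\<^sup>2 * \<xi> - lam * u) (- lam * v)))
      + lam * x * v - (u\<^sup>2 - v\<^sup>2) / 4)"
proof -
  have "of_real (lam\<^sup>2 * \<xi>) - of_real lam * Complex u v = Complex (lam\<^sup>2 * \<xi> - lam * u) (- lam * v)"
    by (simp add: complex_eq_iff)
  then show ?thesis
    by (simp add: I_extension_def power2_eq_square)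
qed

text \<open>The order of quantifiers matters: \<open>M\<close> serves all \<open>x\<close> with |x|
  at most \<open>X\<close> and all \<open>lam > 1\<close>, and \<open>s\<close> depends on
  \<open>\<xi>\<close> but not on \<open>u\<close>, so that the points form one connected path from
  \<open>-lam\<close> to \<open>lam\<close>.\<close>

lemma I_extension_bound_on_tent:
  fixes \<omega> :: "real poly"
  assumes "degree \<omega> \<ge> 2" "t \<noteq> 0"
  shows "\<exists>M>0. \<forall>\<xi>. \<bar>\<xi>\<bar> > M \<longrightarrow> (\<exists>s. \<bar>s\<bar> = 1 \<and> (\<forall>x lam u. \<bar>x\<bar> \<le> X \<longrightarrow> lam > 1 \<longrightarrow> \<bar>u\<bar> \<le> lam \<longrightarrow>
    norm (I_extension \<omega> lam x \<xi> t (Complex u (s * (lam - \<bar>u\<bar>)))) \<le> exp (- lam\<^sup>2 / 4)))"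
proof -
  define p where "p = pderiv \<omega>"
  have deg: "degree p \<ge> 1" using assms(1) by (simp add: p_def degree_pderiv)
  \<comment> \<open>In the bound \<open>(X + 1) / \<bar>t\<bar>\<close>, the part \<open>X\<close>
    outweighs the term with \<open>lam * x\<close>, the 1 is what remains as decay, and the division
    cancels the factor \<open>t\<close> of the phase.\<close>
  obtain R where R: "R \<ge> 1" and low: "\<And>a b. \<bar>a\<bar> \<ge> R \<Longrightarrow> R * \<bar>b\<bar> \<le> \<bar>a\<bar> \<Longrightarrow>
      (X + 1) / \<bar>t\<bar> \<le> sgn (lead_coeff p * a ^ degree p) * Re (poly (cpoly p) (Complex a b))"
    using Re_cpoly_lower_bound[OF deg] by meson
  \<comment> \<open>The extra 1 in \<open>R + 1\<close> pays for \<open>u\<close>: since |u| is at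
    most \<open>lam\<close>, |lam * xi - u| is still at least \<open>lam * R\<close>. Hence
    \<open>a\<close> has the sign of \<open>\<xi>\<close>, and \<open>s\<close> may be defined
    through \<open>\<xi>\<close> alone.\<close>
  show ?thesis
  proof (rule exI[of _ "R + 1"], intro conjI allI impI)
    show "R + 1 > 0" using R by simp
    fix \<xi> assume \<xi>: "\<bar>\<xi>\<bar> > R + 1"
    define s where "s = sgn (t * (lead_coeff p * \<xi> ^ degree p))"
    have "lead_coeff p \<noteq> 0" using deg by auto
    with \<xi> R assms(2) have s: "\<bar>s\<bar> = 1" by (auto simp: s_def abs_sgn_eq)
    have "norm (I_extension \<omega> lam x \<xi> t (Complex u (s * (lam - \<bar>u\<bar>)))) \<le> exp (- lam\<^sup>2 / 4)"
      if x: "\<bar>x\<bar> \<le> X" and lam: "lam > 1" and u: "\<bar>u\<bar> \<le> lam" for x lam u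
    proof -
      define w where "w = lam - \<bar>u\<bar>"
      have w: "0 \<le> w" "w \<le> lam" using u by (auto simp: w_def)
      define a where "a = lam\<^sup>2 * \<xi> - lam * u"
      have a_alt: "a = lam * (lam * \<xi> - u)" by (simp add: a_def power2_eq_square algebra_simps)
      have big: "lam * \<bar>\<xi>\<bar> \<ge> lam * (R + 1)" using \<xi> lam by (intro mult_left_mono) auto
      have sa: "sgn a = sgn \<xi>"
      proof -
        have "lam * R > 0" using lam R by simp
        with big u have "lam * \<bar>\<xi>\<bar> > \<bar>u\<bar>" by (simp add: algebra_simps)
        then have "sgn (lam * \<xi> - u) = sgn \<xi>"
          using lam R \<xi> by (auto simp: sgn_if abs_if split: if_splits)
        then show ?thesis using lam by (simp add: a_alt sgn_mult)
      qed
      have "\<bar>lam * \<xi> - u\<bar> \<ge> lam * \<bar>\<xi>\<bar> - \<bar>u\<bar>"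
        using abs_triangle_ineq2[of "lam * \<xi>" u] lam by (simp add: abs_mult)
      with big u have "\<bar>lam * \<xi> - u\<bar> \<ge> lam * R" by (simp add: algebra_simps)
      then have aR: "\<bar>a\<bar> \<ge> lam\<^sup>2 * R"
        using lam by (simp add: a_alt abs_mult power2_eq_square mult.assoc)
      have lam2: "lam\<^sup>2 \<ge> 1" using lam by (simp add: one_le_power)
      then have "lam\<^sup>2 * R \<ge> 1 * R" using R by (intro mult_right_mono) auto
      with aR have aR1: "\<bar>a\<bar> \<ge> R" by linarith
      obtain \<theta> where \<theta>: "\<bar>\<theta>\<bar> \<le> \<bar>- lam * (s * w)\<bar>" and mv:
        "Im (poly (cpoly \<omega>) (Complex a (- lam * (s * w)))) =
          - lam * (s * w) * Re (poly (cpoly p) (Complex a \<theta>))"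
        using Im_cpoly_mean_value unfolding p_def by meson
      \<comment> \<open>The intermediate point must lie in the cone of \<open>low\<close>. Its
        height is at most \<open>lam\<^sup>2\<close>, which matches the lower bound
        \<open>lam\<^sup>2 * R\<close> for |a|; thus \<open>R\<close> does not depend on
        \<open>lam\<close>.\<close>
      have "\<bar>\<theta>\<bar> \<le> lam * w" using \<theta> s w lam by (simp add: abs_mult)
      also have "\<dots> \<le> lam\<^sup>2" using w lam by (simp add: power2_eq_square)
      finally have "R * \<bar>\<theta>\<bar> \<le> R * lam\<^sup>2" using R by (intro mult_left_mono) auto
      with aR have "R * \<bar>\<theta>\<bar> \<le> \<bar>a\<bar>" by (simp add: mult.commute)
      from low[OF aR1 this] have
        "(X + 1) / \<bar>t\<bar> * \<bar>t\<bar> \<le> sgn (lead_coeff p * a ^ degree p) * Re (poly (cpoly p) (Complex a \<theta>)) * \<bar>t\<bar>"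
        by (rule mult_right_mono) auto
      also have "\<dots> = s * t * Re (poly (cpoly p) (Complex a \<theta>))"
      proof -
        have "sgn (lead_coeff p * a ^ degree p) * \<bar>t\<bar> = s * t"
          unfolding s_def sgn_mult power_sgn sa by (simp only: abs_sgn[of t] ac_simps)
        then show ?thesis by (simp add: ac_simps)
      qed
      finally have key: "X + 1 \<le> s * t * Re (poly (cpoly p) (Complex a \<theta>))"
        using assms(2) by simp
      have "s * x \<le> X" using x s by (auto simp: abs_if split: if_splits)
      with key have "1 \<le> s * t * Re (poly (cpoly p) (Complex a \<theta>)) - s * x" by linarith
      then have "lam * w * 1 \<le> lam * w * (s * t * Re (poly (cpoly p) (Complex a \<theta>)) - s * x)"
        using w lam by (intro mult_left_mono) auto
      then have phase: "t * Im (poly (cpoly \<omega>) (Complex a (- lam * (s * w)))) + lam * x * (s * w) \<le> - lam * w"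
        unfolding mv by (simp add: algebra_simps)
      have "s * s = 1" using s by (auto simp: abs_if split: if_splits)
      then have sw2: "(s * w)\<^sup>2 = w\<^sup>2" by (simp add: power2_eq_square algebra_simps)
      have "u\<^sup>2 = (lam - w)\<^sup>2" by (simp add: w_def)
      \<comment> \<open>Compared with its value at \<open>lam\<close>, the Gaussian grows only by
        exp(lam * w / 2) on the path, half of what the phase gains.\<close>
      then have gauss: "- lam * w - (u\<^sup>2 - (s * w)\<^sup>2) / 4 = - lam\<^sup>2 / 4 - lam * w / 2"
        unfolding sw2 by (simp add: power2_eq_square field_simps)
      have "lam * w \<ge> 0" using w lam by simp
      with phase gauss show ?thesis
        unfolding norm_I_extension a_def w_def[symmetric] by simp
    qed
    with s show "\<exists>s. \<bar>s\<bar> = 1 \<and> (\<forall>x lam u. \<bar>x\<bar> \<le> X \<longrightarrow> lam > 1 \<longrightarrow> \<bar>u\<bar> \<le> lam \<longrightarrow>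
      norm (I_extension \<omega> lam x \<xi> t (Complex u (s * (lam - \<bar>u\<bar>)))) \<le> exp (- lam\<^sup>2 / 4))"
      by blast
  qed
qed

section \<open>Contour deformation and truncation of the integral\<close>

lemma norm_contour_integral_tent:
  fixes f :: "complex \<Rightarrow> complex"
  assumes hol: "f holomorphic_on UNIV" and lam: "lam \<ge> 0" and s: "\<bar>s\<bar> = 1" and "B \<ge> 0"
    and bd: "\<And>u. \<bar>u\<bar> \<le> lam \<Longrightarrow> norm (f (Complex u (s * (lam - \<bar>u\<bar>)))) \<le> B"
  shows "norm (contour_integral (linepath (of_real (- lam)) (of_real lam)) f) \<le> 4 * lam * B"
proof -
  define P where "P = Complex 0 (s * lam)"
  let ?A = "complex_of_real (- lam)" and ?Z = "complex_of_real lam"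
  have cont: "continuous_on S f" for S
    using hol holomorphic_on_imp_continuous_on continuous_on_subset by blast
  have "(f has_contour_integral 0) (linepath ?A P +++ linepath P ?Z +++ linepath ?Z ?A)"
    using hol by (intro Cauchy_theorem_triangle) (auto intro: holomorphic_on_subset)
  from contour_integral_unique[OF this]
  have "contour_integral (linepath ?A P) f + (contour_integral (linepath P ?Z) f
      + contour_integral (linepath ?Z ?A) f) = 0"
    by (simp add: contour_integrable_continuous_linepath cont)
  moreover have "contour_integral (linepath ?Z ?A) f = - contour_integral (linepath ?A ?Z) f"
    using contour_integral_reverse_linepath[OF cont] by blast
  ultimately have eq: "contour_integral (linepath ?A ?Z) f
      = contour_integral (linepath ?A P) f + contour_integral (linepath P ?Z) f"
    by (simp add: algebra_simps)
  \<comment> \<open>Adding the absolute values of real and imaginary part gives a cruder length than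
    sqrt 2 * lam, but avoids the root.\<close>
  have len: "norm (P - ?A) \<le> 2 * lam" "norm (?Z - P) \<le> 2 * lam"
    using cmod_le[of "P - ?A"] cmod_le[of "?Z - P"] lam s by (auto simp: P_def abs_mult)
  have left: "norm (f z) \<le> B" if z: "z \<in> closed_segment ?A P" for z
  proof -
    obtain r where r: "0 \<le> r" "r \<le> 1" "z = (1 - r) *\<^sub>R ?A + r *\<^sub>R P"
      using z by (auto simp: closed_segment_def)
    define u where "u = - ((1 - r) * lam)"
    have ur: "(1 - r) * lam \<ge> 0" "r * lam \<ge> 0" using r lam by auto
    then have u: "\<bar>u\<bar> = lam - r * lam" by (simp add: u_def algebra_simps)
    have "z = Complex u (s * (lam - \<bar>u\<bar>))"
      unfolding u by (simp add: r(3) complex_eq_iff P_def u_def)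
    with bd[of u] u ur show ?thesis by simp
  qed
  have right: "norm (f z) \<le> B" if z: "z \<in> closed_segment P ?Z" for z
  proof -
    obtain r where r: "0 \<le> r" "r \<le> 1" "z = (1 - r) *\<^sub>R P + r *\<^sub>R ?Z"
      using z by (auto simp: closed_segment_def)
    have ur: "(1 - r) * lam \<ge> 0" "r * lam \<ge> 0" using r lam by auto
    then have u: "\<bar>r * lam\<bar> \<le> lam" by (simp add: algebra_simps)
    have "z = Complex (r * lam) (s * (lam - \<bar>r * lam\<bar>))"
      using ur(2) by (simp add: r(3) complex_eq_iff P_def algebra_simps)
    with bd[OF u] show ?thesis by simp
  qed
  have "norm (contour_integral (linepath ?A P) f) \<le> B * norm (P - ?A)"
    using assms(4) left by (intro contour_integral_bound_linepath) (auto simp: contour_integrable_continuous_linepath cont)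
  moreover have "norm (contour_integral (linepath P ?Z) f) \<le> B * norm (?Z - P)"
    using assms(4) right by (intro contour_integral_bound_linepath) (auto simp: contour_integrable_continuous_linepath cont)
  moreover have "B * norm (P - ?A) \<le> B * (2 * lam)" "B * norm (?Z - P) \<le> B * (2 * lam)"
    using len assms(4) by (auto intro!: mult_left_mono)
  ultimately show ?thesis
    unfolding eq
    using norm_triangle_ineq[of "contour_integral (linepath ?A P) f" "contour_integral (linepath P ?Z) f"]
    by (simp add: algebra_simps)
qed

lemma integrable_gaussian_eighth: "integrable lborel (\<lambda>z::real. exp (- (z\<^sup>2 / 8)))"
proof -
  \<comment> \<open>The normal density with standard deviation 2 has exponent -z^2/8 and normalising
    factor 1/sqrt(8 pi).\<close>
  have "integrable lborel (\<lambda>z. sqrt (8 * pi) * normal_density 0 2 z)"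
    by simp
  then show ?thesis by (simp add: normal_density_def real_sqrt_mult)
qed

text \<open>For real \<open>z\<close> the phase has modulus 1. Outside \<open>[-lam, lam]\<close>
  one half of the Gaussian exponent gives the factor \<open>exp (- lam\<^sup>2 / 8)\<close>, and the
  other half keeps the tail integrable, uniformly in all other parameters.\<close>

lemma norm_I_integral_le:
  assumes lam: "lam > 0"
  shows "norm (I_integral \<omega> lam x \<xi> t) \<le>
    norm (contour_integral (linepath (of_real (- lam)) (of_real lam)) (I_extension \<omega> lam x \<xi> t))
    + exp (- lam\<^sup>2 / 8) * (LINT z|lborel. exp (- (z\<^sup>2 / 8)))"
proof -
  let ?g = "I_integrand \<omega> lam x \<xi> t" and ?f = "I_extension \<omega> lam x \<xi> t"
  let ?J = "{- lam..lam}"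
  have int: "set_integrable lborel S ?g" if "S \<in> sets lborel" for S
    using that integrable_I_integrand[of \<omega> lam x \<xi> t] unfolding set_integrable_def
    by (rule integrable_mult_indicator)
  have "I_integral \<omega> lam x \<xi> t = (LINT z:?J \<union> - ?J|lborel. ?g z)"
    unfolding Compl_partition by (simp add: I_integral_def set_lebesgue_integral_def)
  also have "\<dots> = (LINT z:?J|lborel. ?g z) + (LINT z:- ?J|lborel. ?g z)"
    by (intro set_integral_Un int) auto
  finally have split: "I_integral \<omega> lam x \<xi> t = (LINT z:?J|lborel. ?g z) + (LINT z:- ?J|lborel. ?g z)" .
  have inner: "(LINT z:?J|lborel. ?g z) = contour_integral (linepath (of_real (- lam)) (of_real lam)) ?f"
  proof -
    \<comment> \<open>The Lebesgue integral over the interval is also a gauge integral, and on a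
      real segment this is the contour integral.\<close>
    have "(?g has_integral (LINT z:?J|lborel. ?g z)) ?J"
      using set_borel_integral_eq_integral[OF int[of ?J]] by (simp add: integrable_integral)
    then have "((\<lambda>z. ?f (of_real z)) has_integral (LINT z:?J|lborel. ?g z)) ?J"
      by (simp add: I_extension_of_real)
    then have "(?f has_contour_integral (LINT z:?J|lborel. ?g z)) (linepath (of_real (- lam)) (of_real lam))"
      using lam by (simp add: has_contour_integral_linepath_Reals_iff)
    then show ?thesis by (simp add: contour_integral_unique)
  qed
  have outer: "norm (LINT z:- ?J|lborel. ?g z) \<le> exp (- lam\<^sup>2 / 8) * (LINT z|lborel. exp (- (z\<^sup>2 / 8)))"
  proof -
    have "norm (LINT z:- ?J|lborel. ?g z) \<le> (LINT z|lborel. norm (indicator (- ?J) z *\<^sub>R ?g z))"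
      unfolding set_lebesgue_integral_def by (rule integral_norm_bound)
    also have "\<dots> \<le> (LINT z|lborel. exp (- lam\<^sup>2 / 8) * exp (- (z\<^sup>2 / 8)))"
    proof (rule integral_mono)
      show "integrable lborel (\<lambda>z. norm (indicator (- ?J) z *\<^sub>R ?g z))"
        using int[of "- ?J"] unfolding set_integrable_def by (intro integrable_norm) auto
      show "integrable lborel (\<lambda>z. exp (- lam\<^sup>2 / 8) * exp (- (z\<^sup>2 / 8)))"
        using integrable_gaussian_eighth by simp
      fix z :: real
      show "norm (indicator (- ?J) z *\<^sub>R ?g z) \<le> exp (- lam\<^sup>2 / 8) * exp (- (z\<^sup>2 / 8))"
      proof (cases "z \<in> ?J")
        case False
        then have "lam \<le> \<bar>z\<bar>" by auto
        then have "lam\<^sup>2 \<le> z\<^sup>2" using lam by (simp add: abs_le_square_iff[symmetric])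
        moreover have "norm (?g z) = exp (- (z\<^sup>2 / 4))"
          by (simp add: I_integrand_def norm_mult)
        ultimately show ?thesis using False by (simp add: exp_add[symmetric])
      qed simp
    qed
    finally show ?thesis by simp
  qed
  show ?thesis
    unfolding split inner[symmetric]
    using norm_triangle_ineq outer by (rule order_trans[OF _ add_left_mono])
qed

theorem proposition4p1:
  fixes \<omega> :: "real poly"
  assumes "degree \<omega> \<ge> 2"
  shows "\<forall>x0 t :: real. t \<noteq> 0 \<longrightarrow>
    (\<exists>U :: real set. x0 \<in> interior U \<and>
      (\<exists>C \<sigma> M lam0 :: real. C > 0 \<and> \<sigma> > 0 \<and> M > 0 \<and> lam0 > 0 \<and>
        (\<forall>\<xi> x lam :: real. \<bar>\<xi>\<bar> > M \<longrightarrow> x \<in> U \<longrightarrow> lam > lam0 \<longrightarrow>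
          norm (I_integral \<omega> lam x \<xi> t) \<le> C * exp (- \<sigma> * lam\<^sup>2))))"
proof (intro allI impI)
  fix x0 t :: real
  assume t: "t \<noteq> 0"
  define G where "G = (LINT z|lborel. exp (- ((z::real)\<^sup>2 / 8)))"
  have G: "G \<ge> 0" by (simp add: G_def)
  \<comment> \<open>\<open>X\<close> is chosen as \<open>\<bar>x0\<bar> + 1\<close> because the
    neighborhood will be the unit ball around \<open>x0\<close>.\<close>
  obtain M where M: "M > 0" and tent: "\<And>\<xi>. \<bar>\<xi>\<bar> > M \<Longrightarrow>
    \<exists>s. \<bar>s\<bar> = 1 \<and> (\<forall>x lam u. \<bar>x\<bar> \<le> \<bar>x0\<bar> + 1 \<longrightarrow> lam > 1 \<longrightarrow> \<bar>u\<bar> \<le> lam \<longrightarrow>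
      norm (I_extension \<omega> lam x \<xi> t (Complex u (s * (lam - \<bar>u\<bar>)))) \<le> exp (- lam\<^sup>2 / 4))"
    using I_extension_bound_on_tent[OF assms t] by meson
  have bound: "norm (I_integral \<omega> lam x \<xi> t) \<le> (32 + G) * exp (- (1 / 8) * lam\<^sup>2)"
    if \<xi>: "\<bar>\<xi>\<bar> > M" and x: "x \<in> ball x0 1" and lam: "lam > 1" for \<xi> x lam
  proof -
    have x': "\<bar>x\<bar> \<le> \<bar>x0\<bar> + 1" using x by (auto simp: dist_real_def)
    obtain s where s: "\<bar>s\<bar> = 1" and bd: "\<And>u. \<bar>u\<bar> \<le> lam \<Longrightarrow>
      norm (I_extension \<omega> lam x \<xi> t (Complex u (s * (lam - \<bar>u\<bar>)))) \<le> exp (- lam\<^sup>2 / 4)"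
      using tent[OF \<xi>] x' lam by blast
    have "norm (contour_integral (linepath (of_real (- lam)) (of_real lam)) (I_extension \<omega> lam x \<xi> t))
        \<le> 4 * lam * exp (- lam\<^sup>2 / 4)"
      using norm_contour_integral_tent[OF holomorphic_I_extension _ s _ bd] lam by simp
    \<comment> \<open>Half of the exponent is given up to absorb the path length
      \<open>4 * lam\<close>; the remaining 1/8 is the rate of the tail bound as well.\<close>
    also have "\<dots> = 4 * lam * exp (- lam\<^sup>2 / 8) * exp (- lam\<^sup>2 / 8)"
      by (simp add: exp_add[symmetric])
    also have "\<dots> \<le> 32 * exp (- lam\<^sup>2 / 8)"
    proof (intro mult_right_mono)
      \<comment> \<open>This is \<open>lam \<le> lam\<^sup>2\<close>, valid as
        \<open>lam > 1\<close>, written so that e^y >= 1 + y applies with y = lam^2/8.\<close>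
      have "lam \<le> 8 * (lam\<^sup>2 / 8)" using lam by (simp add: power2_eq_square)
      also have "\<dots> \<le> 8 * exp (lam\<^sup>2 / 8)"
        using exp_ge_add_one_self[of "lam\<^sup>2 / 8"] by linarith
      finally show "4 * lam * exp (- lam\<^sup>2 / 8) \<le> 32" by (simp add: exp_minus field_simps)
    qed simp
    finally have "norm (contour_integral (linepath (of_real (- lam)) (of_real lam)) (I_extension \<omega> lam x \<xi> t))
        \<le> 32 * exp (- lam\<^sup>2 / 8)" .
    with norm_I_integral_le[of lam \<omega> x \<xi> t] lam show ?thesis
      by (simp add: G_def algebra_simps)
  qed
  show "\<exists>U :: real set. x0 \<in> interior U \<and>
      (\<exists>C \<sigma> M lam0 :: real. C > 0 \<and> \<sigma> > 0 \<and> M > 0 \<and> lam0 > 0 \<and>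
        (\<forall>\<xi> x lam :: real. \<bar>\<xi>\<bar> > M \<longrightarrow> x \<in> U \<longrightarrow> lam > lam0 \<longrightarrow>
          norm (I_integral \<omega> lam x \<xi> t) \<le> C * exp (- \<sigma> * lam\<^sup>2)))"
    using M G bound
    by (intro exI[of _ "ball x0 1"] conjI exI[of _ "32 + G"] exI[of _ "1 / 8"] exI[of _ M] exI[of _ 1]
        allI impI) (auto simp: interior_open)
qed

end
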